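(* Let $(m(t),\,t\in\mathbb{R}_+)$ be the solution of Problem 1 for a symmetric initial condition $m_0$. If $\Delta>2\int_0^1\bigl|x-\tfrac12\bigr|\,m_0(dx)$ then $m(t)$ converges (weakly, as $t\to\infty$) either to a total consensus or to a partial consensus with $3$ or more components.
   Context: Fix $\Delta\in(0,1]$ and $w\in(0,1)$. $\mathcal{P}[0,1]$ is the set of Borel probability measures on $[0,1]$; $\langle h,\mu\rangle=\int h\,d\mu$. Problem 1: a family $(m(t),\,t\in\mathbb{R}_+)$ with $m(t)\in\mathcal{P}[0,1]$ is a solution of Problem 1 with initial value $m_0\in\mathcal{P}[0,1]$ if $m(0)=m_0$ and, for all bounded measurable $h:[0,1]\to\mathbb{R}$ and $t\ge0$, $$\langle h,m(t)\rangle-\langle h,m(0)\rangle=\int_0^t 2\iint[h(wx+(1-w)y)-h(x)]\,1_{\{|x-y|\le\Delta\}}\,m(s)(dy)\,m(s)(dx)\,ds.$$ For each $m_0$ there is exactly one solution. $\nu\in\mathcal{P}[0,1]$ is symmetric if its image by $x\mapsto1-x$ is $\nu$ itself. A total consensus is a Dirac measure. For limits $m(\infty)$ of $m(t)$, a partial consensus with $c$ components is a measure $\sum_{i=1}^c\alpha_i\delta_{x_i}$ with $\alpha_i>0$, $\sum_i\alpha_i=1$, $x_i\in[0,1]$ and $|x_i-x_j|\ge\Delta$ for $i\ne j$. *)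

theory Defs
  imports "HOL-Probability.Probability"
begin

abbreviation unit_borel :: "real measure" where
  "unit_borel \<equiv> restrict_space borel {0..1}"

text \<open>Since \<open>space (prob_algebra M)\<close> consists of the probability measures on the sigma-algebra
  of \<open>M\<close>, this is the set of Borel probability measures on \<open>[0,1]\<close>.\<close>

abbreviation unit_probs :: "real measure set" where
  "unit_probs \<equiv> space (prob_algebra unit_borel)"

definition interaction ::
    "real \<Rightarrow> real \<Rightarrow> (real \<Rightarrow> real) \<Rightarrow> real measure \<Rightarrow> real" where
  "interaction \<Delta> w h \<mu> =
     2 * (\<integral>x. (\<integral>y. (h (w * x + (1 - w) * y) - h x) * indicator {y. \<bar>x - y\<bar> \<le> \<Delta>} y \<partial>\<mu>) \<partial>\<mu>)"

text \<open>Only the values \<open>m t\<close> with \<open>t \<ge> 0\<close> matter. Integrability in time is demanded explicitly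
  because the Bochner integral of a non-integrable function is \<open>0\<close> by convention.\<close>

definition solves_problem1 ::
    "real \<Rightarrow> real \<Rightarrow> real measure \<Rightarrow> (real \<Rightarrow> real measure) \<Rightarrow> bool" where
  "solves_problem1 \<Delta> w m0 m \<longleftrightarrow>
     (\<forall>t\<ge>0. m t \<in> unit_probs) \<and> m 0 = m0 \<and>
     (\<forall>h t. h \<in> borel_measurable unit_borel \<longrightarrow> bounded (h ` {0..1}) \<longrightarrow> t \<ge> 0 \<longrightarrow>
        set_integrable lborel {0..t} (\<lambda>s. interaction \<Delta> w h (m s)) \<and>
        (\<integral>x. h x \<partial>m t) - (\<integral>x. h x \<partial>m 0) = (LINT s:{0..t}|lborel. interaction \<Delta> w h (m s)))"

definition symmetric_measure :: "real measure \<Rightarrow> bool" where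
  "symmetric_measure \<nu> \<longleftrightarrow> distr \<nu> unit_borel (\<lambda>x. 1 - x) = \<nu>"

text \<open>The library's \<open>weak_conv_m\<close> is for sequences of measures on the whole real line; here the
  index is continuous time and the underlying space is \<open>[0,1]\<close>, where every continuous test
  function is bounded.\<close>

definition weakly_converges :: "(real \<Rightarrow> real measure) \<Rightarrow> real measure \<Rightarrow> bool" where
  "weakly_converges m \<nu> \<longleftrightarrow>
     (\<forall>f :: real \<Rightarrow> real. continuous_on {0..1} f \<longrightarrow>
        ((\<lambda>t. \<integral>x. f x \<partial>m t) \<longlongrightarrow> (\<integral>x. f x \<partial>\<nu>)) at_top)"

definition total_consensus :: "real measure \<Rightarrow> bool" where
  "total_consensus \<nu> \<longleftrightarrow> (\<exists>x\<in>{0..1}. \<nu> = return unit_borel x)"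

definition partial_consensus :: "real \<Rightarrow> nat \<Rightarrow> real measure \<Rightarrow> bool" where
  "partial_consensus \<Delta> c \<nu> \<longleftrightarrow>
     sets \<nu> = sets unit_borel \<and>
     (\<exists>\<alpha> x :: nat \<Rightarrow> real.
        (\<forall>i\<in>{1..c}. \<alpha> i > 0) \<and> (\<Sum>i=1..c. \<alpha> i) = 1 \<and>
        (\<forall>i\<in>{1..c}. x i \<in> {0..1}) \<and>
        (\<forall>i\<in>{1..c}. \<forall>j\<in>{1..c}. i \<noteq> j \<longrightarrow> \<bar>x i - x j\<bar> \<ge> \<Delta>) \<and>
        (\<forall>A\<in>sets unit_borel.
           emeasure \<nu> A = (\<Sum>i=1..c. ennreal (\<alpha> i) * emeasure (return unit_borel (x i)) A)))"

end

theory Submission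
  imports Defs
begin

text \<open>
  Exchanging the two members of an interacting pair shows that every convex test function has a
  nonincreasing integral along a solution (\<open>convex_decreasing\<close>). Monomials are convex on the unit
  interval, so all moments converge, and by the Weierstrass approximation theorem
  \<open>L f = lim \<langle>f, m t\<rangle>\<close> exists for every continuous \<open>f\<close> (\<open>integral_converges\<close>).

  For \<open>x\<^sup>2\<close> the rate of decrease is explicit: it is \<open>2 w (1 - w)\<close> times the mean of \<open>(x - y)\<^sup>2\<close> over
  the interacting pairs. If \<open>f\<close> and \<open>g\<close> are bumps such that points of their supports are at
  distance at least \<open>\<epsilon> > 0\<close> and at most \<open>\<Delta>\<close>, then \<open>L f * L g > 0\<close> would make the second
  moment decrease at a rate bounded away from zero for ever, which is absurd
  (\<open>limit_functional_separated\<close>). Hence distinct points of the support of \<open>L\<close> are at distance at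
  least \<open>\<Delta>\<close>, the support is finite, and \<open>L\<close> is a convex combination of point evaluations there
  (\<open>L_eq_sum\<close>). The limit measure is obtained from these weights directly, without a
  representation or compactness theorem for measures.

  It remains to exclude exactly two atoms \<open>a\<close> and \<open>b\<close>. Symmetry is propagated in the form that
  odd functions about \<open>1/2\<close> integrate to zero at all times (\<open>odd_integral_eq_0\<close>); this follows
  from a Gronwall iteration in the class of odd functions, and replaces the usual appeal to
  uniqueness of the solution for the reflected initial condition. Testing with \<open>x - 1/2\<close> and
  its cube gives \<open>a + b = 1\<close>, so the limit of \<open>\<langle>\<bar>x - 1/2\<bar>, m t\<rangle>\<close> is \<open>\<bar>a - b\<bar> / 2 \<ge> \<Delta> / 2\<close>. But
  \<open>\<bar>x - 1/2\<bar>\<close> is convex, so this limit is at most its initial value, which is less than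
  \<open>\<Delta> / 2\<close>.
\<close>

section \<open>Integration against probability measures on the unit interval\<close>

lemma unit_probsD:
  assumes "\<mu> \<in> unit_probs"
  shows "prob_space \<mu>" "sets \<mu> = sets unit_borel" "space \<mu> = {0..1}"
  using assms sets_eq_imp_space_eq[of \<mu> unit_borel]
  by (auto simp: space_prob_algebra space_restrict_space)

lemma unit_integrable:
  fixes h :: "real \<Rightarrow> real"
  assumes \<mu>: "\<mu> \<in> unit_probs" and h: "h \<in> borel_measurable unit_borel" and "bounded (h ` {0..1})"
  shows "integrable \<mu> h"
proof -
  interpret prob_space \<mu> by (rule unit_probsD[OF \<mu>])
  obtain B where "\<And>x. x \<in> {0..1} \<Longrightarrow> \<bar>h x\<bar> \<le> B"
    using assms(3) by (force simp: bounded_iff)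
  moreover have "h \<in> borel_measurable \<mu>"
    using h measurable_cong_sets[OF unit_probsD(2)[OF \<mu>] refl] by blast
  ultimately show ?thesis
    by (intro integrable_const_bound[where B = B]) (auto simp: unit_probsD(3)[OF \<mu>] intro!: AE_I2)
qed

lemma unit_continuous:
  fixes h :: "real \<Rightarrow> real"
  assumes "continuous_on {0..1} h"
  shows "h \<in> borel_measurable unit_borel" "bounded (h ` {0..1})"
  using assms
  by (auto intro: borel_measurable_continuous_on_restrict
      compact_imp_bounded compact_continuous_image)

lemma unit_integral_mono:
  fixes f g :: "real \<Rightarrow> real"
  assumes \<mu>: "\<mu> \<in> unit_probs"
    and "f \<in> borel_measurable unit_borel" "bounded (f ` {0..1})"
    and "g \<in> borel_measurable unit_borel" "bounded (g ` {0..1})"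
    and "\<And>x. x \<in> {0..1} \<Longrightarrow> f x \<le> g x"
  shows "(\<integral>x. f x \<partial>\<mu>) \<le> (\<integral>x. g x \<partial>\<mu>)"
  using assms by (intro integral_mono unit_integrable) (auto simp: unit_probsD(3)[OF \<mu>])

lemma unit_integral_abs_le:
  fixes f :: "real \<Rightarrow> real"
  assumes \<mu>: "\<mu> \<in> unit_probs" and f: "f \<in> borel_measurable unit_borel"
    and b: "\<And>x. x \<in> {0..1} \<Longrightarrow> \<bar>f x\<bar> \<le> B"
  shows "\<bar>\<integral>x. f x \<partial>\<mu>\<bar> \<le> B"
proof -
  interpret prob_space \<mu> by (rule unit_probsD[OF \<mu>])
  have bd: "bounded (f ` {0..1})" using b by (force simp: bounded_iff)
  have c: "(\<lambda>_::real. K) \<in> borel_measurable unit_borel" "bounded ((\<lambda>_::real. K) ` {0..1::real})" for K :: real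
    by (auto simp: image_constant_conv)
  have "(\<integral>x. f x \<partial>\<mu>) \<le> (\<integral>x. B \<partial>\<mu>)" "(\<integral>x. - B \<partial>\<mu>) \<le> (\<integral>x. f x \<partial>\<mu>)"
    using b by (intro unit_integral_mono[OF \<mu>] f bd c; force simp: abs_le_iff)+
  then show ?thesis by (simp add: prob_space abs_le_iff)
qed

lemma unit_pair_integrable:
  fixes g :: "real \<times> real \<Rightarrow> real"
  assumes \<mu>: "\<mu> \<in> unit_probs" and g: "g \<in> borel_measurable (unit_borel \<Otimes>\<^sub>M unit_borel)"
    and b: "\<And>x y. x \<in> {0..1} \<Longrightarrow> y \<in> {0..1} \<Longrightarrow> \<bar>g (x, y)\<bar> \<le> B"
  shows "integrable (\<mu> \<Otimes>\<^sub>M \<mu>) g"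
proof -
  interpret prob_space \<mu> by (rule unit_probsD[OF \<mu>])
  interpret pair_prob_space \<mu> \<mu> ..
  have "g \<in> borel_measurable (\<mu> \<Otimes>\<^sub>M \<mu>)"
    using g measurable_cong_sets[OF sets_pair_measure_cong[OF unit_probsD(2)[OF \<mu>] unit_probsD(2)[OF \<mu>]] refl]
    by blast
  then show ?thesis
    using b by (intro P.integrable_const_bound[where B = B])
      (auto simp: space_pair_measure unit_probsD(3)[OF \<mu>] intro!: AE_I2)
qed

lemma unit_coordinates_measurable [measurable]:
  "fst \<in> borel_measurable (unit_borel \<Otimes>\<^sub>M unit_borel)"
  "snd \<in> borel_measurable (unit_borel \<Otimes>\<^sub>M unit_borel)"
proof -
  have id: "(\<lambda>x. x) \<in> borel_measurable unit_borel" by (simp add: measurable_restrict_space1)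
  show "fst \<in> borel_measurable (unit_borel \<Otimes>\<^sub>M unit_borel)"
    by (rule measurable_compose[OF measurable_fst id])
  show "snd \<in> borel_measurable (unit_borel \<Otimes>\<^sub>M unit_borel)"
    by (rule measurable_compose[OF measurable_snd id])
qed

section \<open>The interaction rate as an integral over pairs of agents\<close>

definition jump :: "real \<Rightarrow> real \<Rightarrow> (real \<Rightarrow> real) \<Rightarrow> real \<Rightarrow> real \<Rightarrow> real" where
  "jump \<Delta> w h x y = (h (w * x + (1 - w) * y) - h x) * indicator {y. \<bar>x - y\<bar> \<le> \<Delta>} y"

lemma mix_in_unit:
  fixes w x y :: real
  assumes "0 < w" "w < 1" "x \<in> {0..1}" "y \<in> {0..1}"
  shows "w * x + (1 - w) * y \<in> {0..1}"
proof -
  have "w * x + (1 - w) * y \<le> w * 1 + (1 - w) * 1"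
    using assms by (intro add_mono mult_left_mono) auto
  then show ?thesis using assms by auto
qed

lemma jump_measurable:
  assumes w: "0 < w" "w < 1" and h: "h \<in> borel_measurable unit_borel"
  shows "(\<lambda>p. jump \<Delta> w h (fst p) (snd p)) \<in> borel_measurable (unit_borel \<Otimes>\<^sub>M unit_borel)"
proof -
  have "(\<lambda>p. w * fst p + (1 - w) * snd p) \<in> unit_borel \<Otimes>\<^sub>M unit_borel \<rightarrow>\<^sub>M unit_borel"
    using mix_in_unit[OF w]
    by (intro measurable_restrict_space2) (auto simp: space_pair_measure)
  from measurable_compose[OF this h] measurable_compose[OF measurable_fst h]
  have [measurable]:
    "(\<lambda>p. h (w * fst p + (1 - w) * snd p)) \<in> borel_measurable (unit_borel \<Otimes>\<^sub>M unit_borel)"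
    "(\<lambda>p. h (fst p)) \<in> borel_measurable (unit_borel \<Otimes>\<^sub>M unit_borel)"
    by simp_all
  have "(\<lambda>p. jump \<Delta> w h (fst p) (snd p)) = (\<lambda>p. (h (w * fst p + (1 - w) * snd p) - h (fst p))
      * (if \<bar>fst p - snd p\<bar> \<le> \<Delta> then 1 else 0))"
    by (auto simp: jump_def fun_eq_iff)
  then show ?thesis by simp
qed

lemma jump_abs_le:
  assumes "0 < w" "w < 1" "x \<in> {0..1}" "y \<in> {0..1}" and b: "\<And>x. x \<in> {0..1} \<Longrightarrow> \<bar>h x\<bar> \<le> B"
  shows "\<bar>jump \<Delta> w h x y\<bar> \<le> 2 * B"
  using b[OF mix_in_unit[OF assms(1-4)]] b[OF assms(3)]
  by (auto simp: jump_def indicator_def)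

lemma jump_integrable:
  assumes "\<mu> \<in> unit_probs" "0 < w" "w < 1" "h \<in> borel_measurable unit_borel" "bounded (h ` {0..1})"
  shows "integrable (\<mu> \<Otimes>\<^sub>M \<mu>) (\<lambda>p. jump \<Delta> w h (fst p) (snd p))"
proof -
  obtain B where B: "\<And>x. x \<in> {0..1} \<Longrightarrow> \<bar>h x\<bar> \<le> B"
    using assms(5) by (force simp: bounded_iff)
  show ?thesis
    by (rule unit_pair_integrable[OF assms(1) jump_measurable[OF assms(2-4)], where B = "2 * B"])
      (simp only: fst_conv snd_conv jump_abs_le[OF assms(2,3) _ _ B])
qed

text \<open>The product measure is invariant under swapping the coordinates, so the two orders in which a
  pair can interact contribute equally. Only the sum of the two has a sign for convex \<open>h\<close>; the
  factor \<open>2\<close> in the rate is used up by writing out both orders.\<close>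

lemma interaction_eq_symmetrised:
  assumes \<mu>: "\<mu> \<in> unit_probs" and w: "0 < w" "w < 1"
    and h: "h \<in> borel_measurable unit_borel" "bounded (h ` {0..1})"
  shows "integrable (\<mu> \<Otimes>\<^sub>M \<mu>) (\<lambda>p. jump \<Delta> w h (fst p) (snd p) + jump \<Delta> w h (snd p) (fst p))"
    and "interaction \<Delta> w h \<mu> =
      (\<integral>p. jump \<Delta> w h (fst p) (snd p) + jump \<Delta> w h (snd p) (fst p) \<partial>(\<mu> \<Otimes>\<^sub>M \<mu>))"
proof -
  interpret prob_space \<mu> by (rule unit_probsD[OF \<mu>])
  interpret pair_sigma_finite \<mu> \<mu> ..
  let ?J = "\<lambda>p. jump \<Delta> w h (fst p) (snd p)"
  let ?J' = "\<lambda>p. jump \<Delta> w h (snd p) (fst p)"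
  note J = jump_integrable[OF \<mu> w h, of \<Delta>]
  have J': "integrable (\<mu> \<Otimes>\<^sub>M \<mu>) ?J'"
    using integrable_product_swap[OF J] by (simp add: case_prod_beta')
  show "integrable (\<mu> \<Otimes>\<^sub>M \<mu>) (\<lambda>p. ?J p + ?J' p)" using J J' by simp
  have "(\<integral>p. ?J' p \<partial>(\<mu> \<Otimes>\<^sub>M \<mu>)) = (\<integral>p. ?J p \<partial>(\<mu> \<Otimes>\<^sub>M \<mu>))"
    using integral_product_swap[of ?J] J by (simp add: case_prod_beta')
  moreover have "(\<integral>x. \<integral>y. jump \<Delta> w h x y \<partial>\<mu> \<partial>\<mu>) = (\<integral>p. ?J p \<partial>(\<mu> \<Otimes>\<^sub>M \<mu>))"
    using integral_fst'[OF J] by simp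
  ultimately show "interaction \<Delta> w h \<mu> = (\<integral>p. ?J p + ?J' p \<partial>(\<mu> \<Otimes>\<^sub>M \<mu>))"
    using J J' by (simp add: interaction_def jump_def)
qed

text \<open>Jensen's inequality applied to both opinions after the interaction: the weights that \<open>x\<close> and
  \<open>y\<close> receive in \<open>w x + (1 - w) y\<close> and in \<open>w y + (1 - w) x\<close> each add up to \<open>1\<close>.\<close>

lemma interaction_convex_nonpos:
  assumes \<mu>: "\<mu> \<in> unit_probs" and w: "0 < w" "w < 1"
    and h: "convex_on {0..1} h" "continuous_on {0..1} h"
  shows "interaction \<Delta> w h \<mu> \<le> 0"
proof -
  have "jump \<Delta> w h x y + jump \<Delta> w h y x \<le> 0" if "x \<in> {0..1}" "y \<in> {0..1}" for x y
  proof -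
    have "h (w * x + (1 - w) * y) \<le> w * h x + (1 - w) * h y"
      "h (w * y + (1 - w) * x) \<le> w * h y + (1 - w) * h x"
      using convex_onD[OF h(1), of "1 - w"] that w by simp_all
    then have "h (w * x + (1 - w) * y) - h x + (h (w * y + (1 - w) * x) - h y) \<le> 0"
      by (simp add: algebra_simps)
    then show ?thesis by (auto simp: jump_def indicator_def abs_minus_commute)
  qed
  then have "AE p in \<mu> \<Otimes>\<^sub>M \<mu>. 0 \<le> - (jump \<Delta> w h (fst p) (snd p) + jump \<Delta> w h (snd p) (fst p))"
    by (intro AE_I2) (force simp: space_pair_measure unit_probsD(3)[OF \<mu>])
  from integral_nonneg_AE[OF this] show ?thesis
    by (simp add: interaction_eq_symmetrised(2)[OF \<mu> w unit_continuous[OF h(2)]] del: minus_add_distrib)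
qed

text \<open>For the square the symmetrised integrand equals \<open>- 2 w (1 - w) (x - y)\<^sup>2\<close> on interacting pairs.
  Bounding it by a multiple of \<open>f x * g y\<close> turns the double integral into a product of
  single integrals, so that convergence of integrals against one copy of the measure is enough
  to pass to the limit.\<close>

lemma interaction_square_le:
  assumes \<mu>: "\<mu> \<in> unit_probs" and w: "0 < w" "w < 1" and "0 \<le> \<epsilon>"
    and f: "continuous_on {0..1} f" "\<And>x. x \<in> {0..1} \<Longrightarrow> 0 \<le> f x \<and> f x \<le> 1"
    and g: "continuous_on {0..1} g" "\<And>x. x \<in> {0..1} \<Longrightarrow> 0 \<le> g x \<and> g x \<le> 1"
    and sep: "\<And>x y. x \<in> {0..1} \<Longrightarrow> y \<in> {0..1} \<Longrightarrow> f x * g y \<noteq> 0 \<Longrightarrow>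
           \<epsilon> \<le> \<bar>x - y\<bar> \<and> \<bar>x - y\<bar> \<le> \<Delta>"
  shows "interaction \<Delta> w (\<lambda>x. x\<^sup>2) \<mu> \<le> - (2 * w * (1 - w) * \<epsilon>\<^sup>2) * ((\<integral>x. f x \<partial>\<mu>) * (\<integral>x. g x \<partial>\<mu>))"
proof -
  interpret prob_space \<mu> by (rule unit_probsD[OF \<mu>])
  interpret pair_sigma_finite \<mu> \<mu> ..
  let ?k = "2 * w * (1 - w) * \<epsilon>\<^sup>2"
  let ?S = "\<lambda>x y. jump \<Delta> w (\<lambda>x. x\<^sup>2) x y + jump \<Delta> w (\<lambda>x. x\<^sup>2) y x"
  have sq: "continuous_on {0..1} (\<lambda>x::real. x\<^sup>2)" by (intro continuous_intros)
  have le: "?S x y \<le> - ?k * (f x * g y)" if xy: "x \<in> {0..1}" "y \<in> {0..1}" for x y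
  proof (cases "f x * g y = 0")
    case True
    have "?S x y = - (2 * w * (1 - w) * (x - y)\<^sup>2) * indicator {y. \<bar>x - y\<bar> \<le> \<Delta>} y"
      by (auto simp: jump_def indicator_def abs_minus_commute power2_eq_square algebra_simps)
    also have "\<dots> \<le> 0" using w by (simp add: indicator_def)
    finally show ?thesis unfolding True by simp
  next
    case False
    from sep[OF xy False] have d: "\<epsilon>\<^sup>2 \<le> (x - y)\<^sup>2" "\<bar>x - y\<bar> \<le> \<Delta>"
      using \<open>0 \<le> \<epsilon>\<close> by (auto intro: power2_le_iff_abs_le[THEN iffD2] simp: abs_le_square_iff[symmetric])
    have "f x * g y \<le> 1" using f(2)[OF xy(1)] g(2)[OF xy(2)] by (simp add: mult_le_one)
    then have "?k * (f x * g y) \<le> ?k * 1" using w by (intro mult_left_mono) auto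
    also have "\<dots> \<le> 2 * w * (1 - w) * (x - y)\<^sup>2" using d w by (simp add: mult_left_mono)
    also have "\<dots> = - ?S x y"
      using d(2) by (auto simp: jump_def indicator_def abs_minus_commute power2_eq_square algebra_simps)
    finally show ?thesis by simp
  qed
  note fi = unit_integrable[OF \<mu> unit_continuous[OF f(1)]]
  note gi = unit_integrable[OF \<mu> unit_continuous[OF g(1)]]
  have fg: "integrable (\<mu> \<Otimes>\<^sub>M \<mu>) (\<lambda>(x, y). f x * g y)"
  proof (rule unit_pair_integrable[OF \<mu>, where B = 1])
    show "(\<lambda>(x, y). f x * g y) \<in> borel_measurable (unit_borel \<Otimes>\<^sub>M unit_borel)"
      using measurable_compose[OF measurable_fst unit_continuous(1)[OF f(1)], of unit_borel]
        measurable_compose[OF measurable_snd unit_continuous(1)[OF g(1)], of unit_borel]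
      by (simp add: case_prod_beta')
  qed (use f(2) g(2) in \<open>auto simp: mult_le_one abs_mult\<close>)
  have "interaction \<Delta> w (\<lambda>x. x\<^sup>2) \<mu> = (\<integral>p. ?S (fst p) (snd p) \<partial>(\<mu> \<Otimes>\<^sub>M \<mu>))"
    by (rule interaction_eq_symmetrised(2)[OF \<mu> w unit_continuous[OF sq]])
  also have "\<dots> \<le> (\<integral>p. - ?k * (case p of (x, y) \<Rightarrow> f x * g y) \<partial>(\<mu> \<Otimes>\<^sub>M \<mu>))"
    using le interaction_eq_symmetrised(1)[OF \<mu> w unit_continuous[OF sq]] fg
    by (intro integral_mono integrable_mult_right)
      (auto simp: space_pair_measure unit_probsD(3)[OF \<mu>])
  also have "\<dots> = - ?k * (\<integral>p. (case p of (x, y) \<Rightarrow> f x * g y) \<partial>(\<mu> \<Otimes>\<^sub>M \<mu>))"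
    by (rule integral_mult_right_zero)
  also have "(\<integral>p. (case p of (x, y) \<Rightarrow> f x * g y) \<partial>(\<mu> \<Otimes>\<^sub>M \<mu>)) = (\<integral>x. f x \<partial>\<mu>) * (\<integral>x. g x \<partial>\<mu>)"
    using integral_fst'[OF fg] by simp
  finally show ?thesis .
qed

section \<open>Odd test functions\<close>

lemma reflect_measurable: "(\<lambda>x::real. 1 - x) \<in> unit_borel \<rightarrow>\<^sub>M unit_borel"
proof (rule measurable_restrict_space2)
  show "(\<lambda>x. 1 - x) \<in> borel_measurable unit_borel"
    by (intro measurable_restrict_space1) simp
qed auto

lemma jump_reflect:
  assumes "0 < w" "w < 1" "x \<in> {0..1}" "y \<in> {0..1}"
    and odd: "\<And>x. x \<in> {0..1} \<Longrightarrow> h (1 - x) = - h x"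
  shows "jump \<Delta> w h (1 - x) (1 - y) = - jump \<Delta> w h x y"
proof -
  have "w * (1 - x) + (1 - w) * (1 - y) = 1 - (w * x + (1 - w) * y)"
    by (simp add: algebra_simps)
  then show ?thesis
    using odd[OF mix_in_unit[OF assms(1-4)]] odd[OF assms(3)]
    by (simp add: jump_def indicator_def abs_minus_commute)
qed

lemma jump_average_measurable:
  assumes \<mu>: "\<mu> \<in> unit_probs" and w: "0 < w" "w < 1" and h: "h \<in> borel_measurable unit_borel"
  shows "(\<lambda>x. \<integral>y. jump \<Delta> w h x y \<partial>\<mu>) \<in> borel_measurable unit_borel"
proof -
  interpret prob_space \<mu> by (rule unit_probsD[OF \<mu>])
  show ?thesis
  proof (rule borel_measurable_lebesgue_integral)
    show "(\<lambda>(x, y). jump \<Delta> w h x y) \<in> borel_measurable (unit_borel \<Otimes>\<^sub>M \<mu>)"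
      using jump_measurable[OF w h, of \<Delta>]
        measurable_cong_sets[OF sets_pair_measure_cong[OF refl unit_probsD(2)[OF \<mu>]] refl]
      unfolding case_prod_beta' by blast
  qed
qed

lemma jump_section_measurable:
  assumes "0 < w" "w < 1" "h \<in> borel_measurable unit_borel" "x \<in> {0..1}"
  shows "jump \<Delta> w h x \<in> borel_measurable unit_borel"
  using measurable_Pair2[OF jump_measurable[OF assms(1-3)], of x] assms(4) by simp

text \<open>This is the step of the Gronwall iteration. Averaging the jump over the partner \<open>y\<close> gives a
  function \<open>G\<close> of \<open>x\<close>. Its odd part is again an odd test function. Its even part is, for each
  fixed \<open>x\<close>, the integral over \<open>y\<close> of an odd test function, because reflecting both agents changes
  the sign of the jump. Both parts are bounded by \<open>2\<close>, so each contributes at most \<open>2 b\<close>; the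
  factor \<open>2\<close> in the rate gives \<open>8 b\<close>.\<close>

lemma interaction_odd_le:
  assumes \<mu>: "\<mu> \<in> unit_probs" and w: "0 < w" "w < 1"
    and bound: "\<And>g. g \<in> borel_measurable unit_borel \<Longrightarrow> (\<And>x. x \<in> {0..1} \<Longrightarrow> \<bar>g x\<bar> \<le> 1) \<Longrightarrow>
           (\<And>x. x \<in> {0..1} \<Longrightarrow> g (1 - x) = - g x) \<Longrightarrow> \<bar>\<integral>x. g x \<partial>\<mu>\<bar> \<le> b"
    and h: "h \<in> borel_measurable unit_borel" "\<And>x. x \<in> {0..1} \<Longrightarrow> \<bar>h x\<bar> \<le> 1"
      "\<And>x. x \<in> {0..1} \<Longrightarrow> h (1 - x) = - h x"
  shows "\<bar>interaction \<Delta> w h \<mu>\<bar> \<le> 8 * b"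
proof -
  let ?J = "jump \<Delta> w h"
  have bound2: "\<bar>\<integral>x. g x \<partial>\<mu>\<bar> \<le> 2 * b"
    if "g \<in> borel_measurable unit_borel" "\<And>x. x \<in> {0..1} \<Longrightarrow> \<bar>g x\<bar> \<le> 2"
       "\<And>x. x \<in> {0..1} \<Longrightarrow> g (1 - x) = - g x" for g
    using bound[of "\<lambda>x. g x / 2"] that by simp
  define G where "G = (\<lambda>x. \<integral>y. ?J x y \<partial>\<mu>)"
  have Gm: "G \<in> borel_measurable unit_borel"
    unfolding G_def by (rule jump_average_measurable[OF \<mu> w h(1)])
  note Gm' = measurable_compose[OF reflect_measurable Gm]
  have J2: "\<bar>?J x y\<bar> \<le> 2" if "x \<in> {0..1}" "y \<in> {0..1}" for x y
    using jump_abs_le[OF w that h(2)] by simp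
  note Jm = jump_section_measurable[OF w h(1)]
  have G2: "\<bar>G x\<bar> \<le> 2" if "x \<in> {0..1}" for x
    unfolding G_def by (intro unit_integral_abs_le[OF \<mu>] Jm J2 that)
  \<comment> \<open>The even part of \<open>G\<close> is small pointwise, its odd part only after integration.\<close>
  have "(\<lambda>x. (G x + G (1 - x)) / 2) \<in> borel_measurable unit_borel" using Gm Gm' by simp
  moreover have "\<bar>(G x + G (1 - x)) / 2\<bar> \<le> 2 * b" if x: "x \<in> {0..1}" for x
  proof -
    have x': "1 - x \<in> {0..1}" using x by simp
    let ?k = "\<lambda>y. (?J x y + ?J (1 - x) y) / 2"
    have "integrable \<mu> (?J z)" if "z \<in> {0..1}" for z
      using J2[OF that] by (intro unit_integrable[OF \<mu>] Jm that) (force simp: bounded_iff)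
    then have "(G x + G (1 - x)) / 2 = (\<integral>y. ?k y \<partial>\<mu>)"
      using x x' by (simp add: G_def)
    moreover have "\<bar>\<integral>y. ?k y \<partial>\<mu>\<bar> \<le> 2 * b"
    proof (rule bound2)
      show "?k \<in> borel_measurable unit_borel" using Jm[OF x] Jm[OF x'] by simp
      fix y :: real assume y: "y \<in> {0..1}"
      show "\<bar>?k y\<bar> \<le> 2" using J2[OF x y] J2[OF x' y] abs_triangle_ineq[of "?J x y" "?J (1 - x) y"] by simp
      have "?J (1 - x) (1 - y) = - ?J x y" by (intro jump_reflect w x y h(3))
      moreover have "?J (1 - (1 - x)) (1 - y) = - ?J (1 - x) y"
        by (intro jump_reflect w x' y h(3))
      ultimately show "?k (1 - y) = - ?k y" by (simp add: field_simps)
    qed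
    ultimately show ?thesis by simp
  qed
  ultimately have even: "\<bar>\<integral>x. (G x + G (1 - x)) / 2 \<partial>\<mu>\<bar> \<le> 2 * b"
    by (rule unit_integral_abs_le[OF \<mu>])
  have odd: "\<bar>\<integral>x. (G x - G (1 - x)) / 2 \<partial>\<mu>\<bar> \<le> 2 * b"
  proof (rule bound2)
    show "(\<lambda>x. (G x - G (1 - x)) / 2) \<in> borel_measurable unit_borel" using Gm Gm' by simp
    show "\<bar>(G x - G (1 - x)) / 2\<bar> \<le> 2" if "x \<in> {0..1}" for x
      using G2[OF that] G2[of "1 - x"] that by force
  qed (simp add: field_simps)
  have int: "integrable \<mu> G" "integrable \<mu> (\<lambda>x. G (1 - x))"
    by (intro unit_integrable[OF \<mu>] Gm Gm'; use G2 in \<open>auto simp: bounded_iff intro!: exI[of _ 2]\<close>)+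
  have "(\<integral>x. G x \<partial>\<mu>) = (\<integral>x. (G x - G (1 - x)) / 2 + (G x + G (1 - x)) / 2 \<partial>\<mu>)"
    by (rule Bochner_Integration.integral_cong) (auto simp: field_simps)
  also have "\<dots> = (\<integral>x. (G x - G (1 - x)) / 2 \<partial>\<mu>) + (\<integral>x. (G x + G (1 - x)) / 2 \<partial>\<mu>)"
    using int by (intro Bochner_Integration.integral_add) auto
  finally have "\<bar>\<integral>x. G x \<partial>\<mu>\<bar> \<le> 4 * b" using even odd by linarith
  then show ?thesis by (simp add: interaction_def G_def jump_def)
qed

section \<open>Solutions of the evolution equation\<close>

locale problem1_solution =
  fixes \<Delta> w :: real and m0 :: "real measure" and m :: "real \<Rightarrow> real measure"
  assumes \<Delta>_pos: "0 < \<Delta>" and w: "0 < w" "w < 1" and solves: "solves_problem1 \<Delta> w m0 m"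
begin

lemma unit_prob: "t \<ge> 0 \<Longrightarrow> m t \<in> unit_probs"
  and initial: "m 0 = m0"
  and rate_integrable: "h \<in> borel_measurable unit_borel \<Longrightarrow> bounded (h ` {0..1}) \<Longrightarrow> t \<ge> 0 \<Longrightarrow>
         set_integrable lborel {0..t} (\<lambda>s. interaction \<Delta> w h (m s))"
  and evolution: "h \<in> borel_measurable unit_borel \<Longrightarrow> bounded (h ` {0..1}) \<Longrightarrow> t \<ge> 0 \<Longrightarrow>
         (\<integral>x. h x \<partial>m t) - (\<integral>x. h x \<partial>m 0) = (LINT s:{0..t}|lborel. interaction \<Delta> w h (m s))"
  using solves by (auto simp: solves_problem1_def)

text \<open>With \<open>c = 0\<close> this yields monotonicity, with \<open>c < 0\<close> a definite decrease.\<close>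

lemma increment_le:
  assumes h: "h \<in> borel_measurable unit_borel" "bounded (h ` {0..1})" and st: "0 \<le> s" "s \<le> t"
    and rate: "\<And>u. s \<le> u \<Longrightarrow> u \<le> t \<Longrightarrow> interaction \<Delta> w h (m u) \<le> c"
  shows "(\<integral>x. h x \<partial>m t) - (\<integral>x. h x \<partial>m s) \<le> c * (t - s)"
proof -
  let ?I = "\<lambda>u. interaction \<Delta> w h (m u)"
  note I = rate_integrable[OF h, unfolded set_integrable_def]
  have "(\<integral>x. h x \<partial>m t) - (\<integral>x. h x \<partial>m s) = (LINT u:{0..t}|lborel. ?I u) - (LINT u:{0..s}|lborel. ?I u)"
    using evolution[OF h, of t] evolution[OF h, of s] st by simp
  also have "\<dots> = (\<integral>u. indicator {0..t} u *\<^sub>R ?I u - indicator {0..s} u *\<^sub>R ?I u \<partial>lborel)"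
    unfolding set_lebesgue_integral_def using I[of t] I[of s] st by simp
  also have "\<dots> \<le> (\<integral>u. c * indicator {s<..t} u \<partial>lborel)"
  proof (intro integral_mono integrable_mult_right Bochner_Integration.integrable_diff)
    show "integrable lborel (indicator {s<..t} :: real \<Rightarrow> real)"
      using st by (intro integrable_real_indicator) auto
  qed (use st rate I[of t] I[of s] in \<open>auto simp: indicator_def\<close>)
  also have "\<dots> = c * (t - s)" using st by simp
  finally show ?thesis .
qed

text \<open>The initial integral vanishes by symmetry, and the bound with \<open>n\<close> inserted into the evolution
  equation gives the bound with \<open>n + 1\<close> after integration in time.\<close>

lemma odd_integral_le:
  assumes sym: "symmetric_measure m0" and "0 \<le> t" and "h \<in> borel_measurable unit_borel"
    and "\<And>x. x \<in> {0..1} \<Longrightarrow> \<bar>h x\<bar> \<le> 1" and "\<And>x. x \<in> {0..1} \<Longrightarrow> h (1 - x) = - h x"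
  shows "\<bar>\<integral>x. h x \<partial>m t\<bar> \<le> (8 * t) ^ n / fact n"
  using assms(2-)
proof (induction n arbitrary: t h)
  case 0
  then show ?case using unit_integral_abs_le[OF unit_prob, of t h 1] by simp
next
  case (Suc n)
  note h = Suc.prems(2-4)
  have hb: "bounded (h ` {0..1})" using h(2) by (force simp: bounded_iff)
  let ?I = "\<lambda>s. interaction \<Delta> w h (m s)"
  have m0: "m0 \<in> unit_probs" using unit_prob[of 0] initial by simp
  have "(\<integral>x. h x \<partial>m0) = (\<integral>x. h x \<partial>distr m0 unit_borel (\<lambda>x. 1 - x))"
    using sym by (simp add: symmetric_measure_def)
  also have "\<dots> = (\<integral>x. h (1 - x) \<partial>m0)"
    using reflect_measurable measurable_cong_sets[OF unit_probsD(2)[OF m0] refl]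
    by (intro integral_distr h) blast
  also have "\<dots> = (\<integral>x. - h x \<partial>m0)"
    using h(3) by (intro Bochner_Integration.integral_cong) (auto simp: unit_probsD(3)[OF m0])
  finally have "(\<integral>x. h x \<partial>m 0) = 0" using initial by simp
  then have "\<bar>\<integral>x. h x \<partial>m t\<bar> = \<bar>LINT s:{0..t}|lborel. ?I s\<bar>"
    using evolution[OF h(1) hb Suc.prems(1)] by simp
  also have "\<dots> \<le> (\<integral>s. \<bar>indicator {0..t} s *\<^sub>R ?I s\<bar> \<partial>lborel)"
    unfolding set_lebesgue_integral_def by (rule integral_abs_bound)
  also have "\<dots> \<le> (\<integral>s. 8 * 8 ^ n / fact n * (s ^ n * indicator {0..t} s) \<partial>lborel)"
  proof (rule integral_mono)
    show "integrable lborel (\<lambda>s. \<bar>indicator {0..t} s *\<^sub>R ?I s\<bar>)"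
      using rate_integrable[OF h(1) hb Suc.prems(1)] by (simp add: set_integrable_def)
    have "integrable lborel (\<lambda>s. indicator {0..t} s *\<^sub>R s ^ n)"
      by (intro borel_integrable_compact continuous_intros) auto
    then show "integrable lborel (\<lambda>s. 8 * 8 ^ n / fact n * (s ^ n * indicator {0..t} s))"
      by (intro integrable_mult_right) (simp add: mult.commute)
    have "\<bar>?I s\<bar> \<le> 8 * 8 ^ n / fact n * s ^ n" if "s \<in> {0..t}" for s
    proof -
      have "\<bar>?I s\<bar> \<le> 8 * ((8 * s) ^ n / fact n)"
        using that by (intro interaction_odd_le[OF unit_prob w _ h] Suc.IH) auto
      then show ?thesis by (simp add: power_mult_distrib)
    qed
    then show "\<bar>indicator {0..t} s *\<^sub>R ?I s\<bar> \<le> 8 * 8 ^ n / fact n * (s ^ n * indicator {0..t} s)" for s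
      by (auto simp: indicator_def)
  qed
  also have "\<dots> = 8 * 8 ^ n / fact n * (t ^ Suc n / Suc n)"
    using integral_power[OF Suc.prems(1), of n] by simp
  also have "\<dots> = (8 * t) ^ Suc n / fact (Suc n)"
    by (simp add: power_mult_distrib field_simps)
  finally show ?case .
qed

lemma odd_integral_eq_0:
  fixes h :: "real \<Rightarrow> real"
  assumes sym: "symmetric_measure m0" and "0 \<le> t" and h: "h \<in> borel_measurable unit_borel"
    and "\<And>x. x \<in> {0..1} \<Longrightarrow> \<bar>h x\<bar> \<le> 1" and "\<And>x. x \<in> {0..1} \<Longrightarrow> h (1 - x) = - h x"
  shows "(\<integral>x. h x \<partial>m t) = 0"
proof -
  have "(\<lambda>n. (8 * t) ^ n / fact n) \<longlonglongrightarrow> 0"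
    using summable_LIMSEQ_zero[OF summable_exp[of "8 * t"]] by (simp add: field_simps)
  moreover have "\<bar>\<integral>x. h x \<partial>m t\<bar> \<le> (8 * t) ^ n / fact n" for n
    by (intro odd_integral_le assms)
  ultimately have "\<bar>\<integral>x. h x \<partial>m t\<bar> \<le> 0" by (intro LIMSEQ_le_const) auto
  then show ?thesis by simp
qed

lemma convex_decreasing:
  assumes "convex_on {0..1} h" "continuous_on {0..1} h" "0 \<le> s" "s \<le> t"
  shows "(\<integral>x. h x \<partial>m t) \<le> (\<integral>x. h x \<partial>m s)"
  using increment_le[OF unit_continuous[OF assms(2)] assms(3,4), of 0]
    interaction_convex_nonpos[OF unit_prob w assms(1,2)] assms(3)
  by simp

end

section \<open>Positive functionals that vanish on close pairs of bumps\<close>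

definition tent :: "real \<Rightarrow> real \<Rightarrow> real \<Rightarrow> real" where
  "tent c r x = max 0 (1 - \<bar>x - c\<bar> / r)"

lemma continuous_on_tent: "continuous_on A (tent c r)"
  unfolding tent_def by (cases "r = 0") (auto intro!: continuous_intros)

lemma tent_bounds: "r > 0 \<Longrightarrow> 0 \<le> tent c r x" "r > 0 \<Longrightarrow> tent c r x \<le> 1"
  by (auto simp: tent_def)

lemma tent_eq_0_iff: "r > 0 \<Longrightarrow> tent c r x = 0 \<longleftrightarrow> r \<le> \<bar>x - c\<bar>"
  by (auto simp: tent_def max_def field_simps)

text \<open>The properties of the limit functional that force it to be a finite combination of point
  evaluations. Only the values of test functions on the unit interval matter, by monotonicity.
  The last assumption says that the functional does not charge two separate places that are
  close enough to interact.\<close>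

locale separated_functional =
  fixes L :: "(real \<Rightarrow> real) \<Rightarrow> real" and \<Delta> :: real
  assumes \<Delta>_pos: "0 < \<Delta>"
    and L_add: "\<And>f g. continuous_on {0..1} f \<Longrightarrow> continuous_on {0..1} g \<Longrightarrow>
           L (\<lambda>x. f x + g x) = L f + L g"
    and L_scale: "\<And>f c. continuous_on {0..1} f \<Longrightarrow> L (\<lambda>x. c * f x) = c * L f"
    and L_mono: "\<And>f g. continuous_on {0..1} f \<Longrightarrow> continuous_on {0..1} g \<Longrightarrow>
           (\<And>x. x \<in> {0..1} \<Longrightarrow> f x \<le> g x) \<Longrightarrow> L f \<le> L g"
    and L_one: "L (\<lambda>_. 1) = 1"
    and L_separated: "\<And>f g \<epsilon>. 0 < \<epsilon> \<Longrightarrow> continuous_on {0..1} f \<Longrightarrow> continuous_on {0..1} g \<Longrightarrow>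
           (\<And>x. x \<in> {0..1} \<Longrightarrow> 0 \<le> f x \<and> f x \<le> 1) \<Longrightarrow> (\<And>x. x \<in> {0..1} \<Longrightarrow> 0 \<le> g x \<and> g x \<le> 1) \<Longrightarrow>
           (\<And>x y. x \<in> {0..1} \<Longrightarrow> y \<in> {0..1} \<Longrightarrow> f x * g y \<noteq> 0 \<Longrightarrow>
              \<epsilon> \<le> \<bar>x - y\<bar> \<and> \<bar>x - y\<bar> \<le> \<Delta>) \<Longrightarrow>
           L f * L g = 0"
begin

text \<open>This is the support of the functional, described without reference to a representing measure.\<close>

definition atoms :: "real set" where
  "atoms = {x \<in> {0..1}. \<forall>r>0. 0 < L (tent x r)}"

lemma L_const: "L (\<lambda>_. c) = c"
  using L_scale[of "\<lambda>_. 1" c] L_one by simp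

lemma L_sum:
  assumes "finite C" "\<And>i. i \<in> C \<Longrightarrow> continuous_on {0..1} (f i)"
  shows "L (\<lambda>x. \<Sum>i\<in>C. f i x) = (\<Sum>i\<in>C. L (f i))"
  using assms by (induction C) (simp_all add: L_const L_add continuous_on_sum)

lemma atoms_separated:
  assumes "x \<in> atoms" "y \<in> atoms" "x \<noteq> y"
  shows "\<Delta> \<le> \<bar>x - y\<bar>"
proof (rule ccontr)
  assume "\<not> \<Delta> \<le> \<bar>x - y\<bar>"
  define r where "r = min (\<bar>x - y\<bar> / 4) ((\<Delta> - \<bar>x - y\<bar>) / 2)"
  have r: "0 < r" "r \<le> \<bar>x - y\<bar> / 4" "r \<le> (\<Delta> - \<bar>x - y\<bar>) / 2"
    using \<open>\<not> \<Delta> \<le> \<bar>x - y\<bar>\<close> \<open>x \<noteq> y\<close>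
    by (simp_all only: r_def min.cobounded1 min.cobounded2) auto
  have "L (tent x r) * L (tent y r) = 0"
  proof (rule L_separated[of "\<bar>x - y\<bar> / 2"])
    fix u v assume "tent x r u * tent y r v \<noteq> 0"
    then have "\<bar>u - x\<bar> < r" "\<bar>v - y\<bar> < r" using r(1) by (auto simp: tent_eq_0_iff)
    moreover have "\<bar>x - y\<bar> - \<bar>u - x\<bar> - \<bar>v - y\<bar> \<le> \<bar>u - v\<bar>" "\<bar>u - v\<bar> \<le> \<bar>x - y\<bar> + \<bar>u - x\<bar> + \<bar>v - y\<bar>"
      by linarith+
    ultimately show "\<bar>x - y\<bar> / 2 \<le> \<bar>u - v\<bar> \<and> \<bar>u - v\<bar> \<le> \<Delta>"
      using r(2,3) by auto
  qed (use r \<open>x \<noteq> y\<close> in \<open>auto simp: continuous_on_tent tent_bounds\<close>)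
  moreover have "0 < L (tent x r)" "0 < L (tent y r)" using assms r(1) by (auto simp: atoms_def)
  ultimately show False by simp
qed

text \<open>Each cell \<open>[k \<Delta>, (k + 1) \<Delta>)\<close> contains at most one atom, because a cell is shorter than the
  distance between two atoms.\<close>

lemma finite_atoms: "finite atoms"
proof (rule finite_imageD)
  show "inj_on (\<lambda>x. \<lfloor>x / \<Delta>\<rfloor>) atoms"
  proof (rule inj_onI, rule ccontr)
    fix x y assume *: "x \<in> atoms" "y \<in> atoms" "\<lfloor>x / \<Delta>\<rfloor> = \<lfloor>y / \<Delta>\<rfloor>" "x \<noteq> y"
    have "\<bar>x / \<Delta> - y / \<Delta>\<bar> < 1" using *(3) by linarith
    then have "\<bar>x - y\<bar> < \<Delta>" using \<Delta>_pos by (simp add: diff_divide_distrib[symmetric] abs_divide)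
    with atoms_separated[OF *(1,2,4)] show False by simp
  qed
  have "(\<lambda>x. \<lfloor>x / \<Delta>\<rfloor>) ` atoms \<subseteq> {0..\<lfloor>1 / \<Delta>\<rfloor>}"
    using \<Delta>_pos by (auto simp: atoms_def intro!: floor_mono divide_right_mono)
  then show "finite ((\<lambda>x. \<lfloor>x / \<Delta>\<rfloor>) ` atoms)" by (rule finite_subset) simp
qed

text \<open>The set where \<open>f\<close> is at least \<open>e\<close> is compact and avoids the support, so it is covered by
  finitely many tents on which the functional is not positive; away from it \<open>f\<close> is below \<open>e\<close>.\<close>

lemma L_vanish:
  assumes f: "continuous_on {0..1} f" and f0: "\<And>x. x \<in> atoms \<Longrightarrow> f x = 0"
  shows "L f \<le> 0"
proof (rule field_le_epsilon)
  fix e :: real assume "0 < e"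
  define K where "K = {x \<in> {0..1}. e \<le> f x}"
  have "K = {0..1} \<inter> f -` {e..}" by (auto simp: K_def)
  then have "closed K"
    using continuous_closed_preimage[OF f closed_atLeastAtMost closed_atLeast] by simp
  moreover have "bounded K" by (rule bounded_subset[of "{0..1}"]) (auto simp: K_def)
  ultimately have "compact K" by (simp add: compact_eq_bounded_closed)
  have "\<exists>r>0. L (tent y r) \<le> 0" if "y \<in> K" for y
    using that f0[of y] \<open>0 < e\<close> by (fastforce simp: K_def atoms_def not_less)
  then obtain r where r: "\<And>y. y \<in> K \<Longrightarrow> 0 < r y" "\<And>y. y \<in> K \<Longrightarrow> L (tent y (r y)) \<le> 0"
    by metis
  obtain C where C: "C \<subseteq> K" "finite C" "K \<subseteq> (\<Union>y\<in>C. ball y (r y / 2))"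
  proof (rule compactE_image[OF \<open>compact K\<close>, of K "\<lambda>y. ball y (r y / 2)"])
    show "K \<subseteq> (\<Union>y\<in>K. ball y (r y / 2))" using r(1) by force
  qed auto
  obtain M where M: "0 \<le> M" "\<And>x. x \<in> {0..1} \<Longrightarrow> f x \<le> M"
  proof -
    obtain M where "\<And>x. x \<in> {0..1} \<Longrightarrow> \<bar>f x\<bar> \<le> M"
      using compact_imp_bounded[OF compact_continuous_image[OF f compact_Icc]]
      by (force simp: bounded_iff)
    then show ?thesis by (intro that[of "\<bar>M\<bar>"]) force+
  qed
  let ?T = "\<lambda>x. \<Sum>y\<in>C. tent y (r y) x"
  have T: "continuous_on {0..1} ?T" by (intro continuous_on_sum continuous_on_tent)
  \<comment> \<open>The balls have half the radius of the tents, so a covering tent is at least \<open>1/2\<close> on its ball;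
    the factor \<open>2\<close> makes up for this.\<close>
  have le: "f x \<le> e + 2 * M * ?T x" if x: "x \<in> {0..1}" for x
  proof -
    have T0: "0 \<le> ?T x" using C(1) r(1) by (intro sum_nonneg tent_bounds) auto
    show ?thesis
    proof (cases "x \<in> K")
      case True
      then obtain y where y: "y \<in> C" "\<bar>x - y\<bar> < r y / 2"
        using C(3) by (auto simp: dist_real_def abs_minus_commute)
      have "r y > 0" using C(1) r(1) y(1) by auto
      then have "1 / 2 \<le> tent y (r y) x" using y(2) by (simp add: tent_def field_simps max_def)
      also have "\<dots> \<le> ?T x"
        using C r(1) y(1) by (intro member_le_sum tent_bounds) auto
      finally have "M \<le> 2 * M * ?T x" using mult_left_mono[of "1/2" "?T x" "2 * M"] M(1) by simp
      with M(2)[OF x] \<open>0 < e\<close> show ?thesis by linarith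
    next
      case False
      then show ?thesis using x T0 M(1) by (auto simp: K_def intro!: add_increasing2)
    qed
  qed
  have "L f \<le> L (\<lambda>x. e + 2 * M * ?T x)"
    by (intro L_mono f continuous_intros T le)
  also have "\<dots> = e + 2 * M * (\<Sum>y\<in>C. L (tent y (r y)))"
    using L_add[of "\<lambda>_. e" "\<lambda>x. 2 * M * ?T x"] T
    by (simp add: L_const L_scale L_sum[OF C(2)] continuous_on_tent continuous_on_mult_left)
  also have "\<dots> \<le> 0 + e"
  proof -
    have "(\<Sum>y\<in>C. L (tent y (r y))) \<le> 0" using C(1) r(2) by (intro sum_nonpos) auto
    then show ?thesis using M(1) by (simp add: mult_nonneg_nonpos)
  qed
  finally show "L f \<le> 0 + e" .
qed

text \<open>Tents of radius \<open>\<Delta>\<close> interpolate at the atoms, since each of them vanishes at all other atoms.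
  The difference between \<open>f\<close> and its interpolant vanishes on the support.\<close>

lemma L_eq_sum:
  assumes f: "continuous_on {0..1} f"
  shows "L f = (\<Sum>s\<in>atoms. L (tent s \<Delta>) * f s)"
proof -
  let ?R = "\<lambda>x. \<Sum>s\<in>atoms. f s * tent s \<Delta> x"
  have R: "continuous_on {0..1} ?R" by (intro continuous_intros continuous_on_tent)
  have fR: "f x = ?R x" if "x \<in> atoms" for x
  proof -
    have "?R x = (\<Sum>s\<in>atoms. if s = x then f x else 0)"
      using atoms_separated[OF that] \<Delta>_pos
      by (intro sum.cong) (auto simp: tent_eq_0_iff tent_def)
    then show ?thesis using that finite_atoms by simp
  qed
  have "L (\<lambda>x. f x + (- 1) * ?R x) \<le> 0" "L (\<lambda>x. ?R x + (- 1) * f x) \<le> 0"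
    using fR by (intro L_vanish continuous_intros f R; simp)+
  moreover have "L (\<lambda>x. f x + (- 1) * ?R x) = L f - L ?R" "L (\<lambda>x. ?R x + (- 1) * f x) = L ?R - L f"
    by (subst L_add L_scale; (intro continuous_intros f R)?; simp add: L_scale[where c = "-1", simplified] f R)+
  ultimately have "L f = L ?R" by linarith
  also have "\<dots> = (\<Sum>s\<in>atoms. L (tent s \<Delta>) * f s)"
    by (subst L_sum[OF finite_atoms])
      (auto simp: L_scale continuous_on_tent mult.commute intro!: continuous_intros)
  finally show ?thesis .
qed

end

section \<open>Limits of functions of a real variable\<close>

lemma polynomial_approximation_unit:
  fixes f :: "real \<Rightarrow> real"
  assumes "continuous_on {0..1} f" "0 < e"
  obtains a n where "\<And>x. x \<in> {0..1} \<Longrightarrow> \<bar>f x - (\<Sum>i\<le>n::nat. a i * x ^ i)\<bar> < e"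
proof -
  obtain g where "real_polynomial_function g" "\<And>x. x \<in> {0..1} \<Longrightarrow> \<bar>f x - g x\<bar> < e"
    using Stone_Weierstrass_real_polynomial_function[OF compact_Icc assms] by blast
  then show ?thesis using that by (auto simp: real_polynomial_function_iff_sum)
qed

lemma eventually_at_top_if_nonneg:
  fixes P :: "real \<Rightarrow> bool"
  assumes "\<And>t. 0 \<le> t \<Longrightarrow> P t"
  shows "eventually P at_top"
  using eventually_ge_at_top[of 0] by eventually_elim (rule assms)

lemma decreasing_bounded_below_converges:
  fixes F :: "real \<Rightarrow> real"
  assumes dec: "\<And>s t. 0 \<le> s \<Longrightarrow> s \<le> t \<Longrightarrow> F t \<le> F s" and low: "\<And>t. 0 \<le> t \<Longrightarrow> b \<le> F t"
  shows "\<exists>l. (F \<longlongrightarrow> l) at_top"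
proof
  have bdd: "bdd_below (F ` {0..})" by (rule bdd_belowI2[where m = b]) (use low in auto)
  show "(F \<longlongrightarrow> (INF t\<in>{0..}. F t)) at_top"
  proof (rule decreasing_tendsto)
    show "\<forall>\<^sub>F t in at_top. (INF t\<in>{0..}. F t) \<le> F t"
      by (rule eventually_at_top_if_nonneg) (auto intro: cINF_lower bdd)
    fix x assume "(INF t\<in>{0..}. F t) < x"
    then obtain s where s: "0 \<le> s" "F s < x" by (auto simp: cINF_less_iff[OF _ bdd])
    show "\<forall>\<^sub>F t in at_top. F t < x"
      using eventually_ge_at_top[of s]
      by eventually_elim (use dec[OF s(1)] s(2) in force)
  qed
qed

text \<open>Completeness of the reals, in the form needed to transfer convergence from polynomials to
  their uniform limits.\<close>

lemma converges_if_uniformly_near_convergent: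
  fixes F :: "'a \<Rightarrow> real"
  assumes nt: "A \<noteq> bot"
    and near: "\<And>e. 0 < e \<Longrightarrow> \<exists>G l. (G \<longlongrightarrow> l) A \<and> (\<forall>\<^sub>F t in A. \<bar>F t - G t\<bar> \<le> e)"
  shows "\<exists>l. (F \<longlongrightarrow> l) A"
proof -
  have "\<forall>n. \<exists>G l. (G \<longlongrightarrow> l) A \<and> (\<forall>\<^sub>F t in A. \<bar>F t - G t\<bar> \<le> 1 / Suc n)"
    using near by simp
  then obtain G l where G: "\<And>n. (G n \<longlongrightarrow> l n) A" "\<And>n. \<forall>\<^sub>F t in A. \<bar>F t - G n t\<bar> \<le> 1 / Suc n"
    by metis
  have dist: "\<bar>l n - l k\<bar> \<le> 1 / Suc n + 1 / Suc k" for n k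
  proof (rule tendsto_upperbound[OF _ _ nt])
    show "((\<lambda>t. \<bar>G n t - G k t\<bar>) \<longlongrightarrow> \<bar>l n - l k\<bar>) A" by (intro tendsto_intros G)
    show "\<forall>\<^sub>F t in A. \<bar>G n t - G k t\<bar> \<le> 1 / Suc n + 1 / Suc k"
      using G(2)[of n] G(2)[of k] by eventually_elim linarith
  qed
  have "Cauchy l"
  proof (rule metric_CauchyI)
    fix e :: real assume "0 < e"
    then obtain N where N: "1 / Suc N < e / 2"
      using reals_Archimedean[of "e / 2"] by (auto simp: inverse_eq_divide)
    have small: "1 / Suc n < e / 2" if "n \<ge> N" for n
      by (rule le_less_trans[OF _ N]) (use that in \<open>simp add: frac_le\<close>)
    show "\<exists>N. \<forall>n\<ge>N. \<forall>k\<ge>N. dist (l n) (l k) < e"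
    proof (intro exI allI impI)
      fix n k assume "N \<le> n" "N \<le> k"
      then show "dist (l n) (l k) < e"
        using dist[of n k] small[of n] small[of k] by (simp add: dist_real_def)
    qed
  qed
  then obtain L where L: "l \<longlonglongrightarrow> L" using convergent_eq_Cauchy by blast
  have "(F \<longlongrightarrow> L) A"
  proof (rule tendstoI)
    fix e :: real assume e: "0 < e"
    have "\<forall>\<^sub>F n in sequentially. dist (l n) L < e / 3 \<and> 1 / Suc n < e / 3"
      using tendstoD[OF L, of "e / 3"] order_tendstoD(2)[OF LIMSEQ_inverse_real_of_nat, of "e / 3"] e
      by (auto simp: inverse_eq_divide elim: eventually_conj)
    then obtain n where n: "dist (l n) L < e / 3" "1 / Suc n < e / 3"
      using eventually_happens'[OF sequentially_bot] by blast
    have "\<forall>\<^sub>F t in A. dist (G n t) (l n) < e / 3" using tendstoD[OF G(1), of "e / 3"] e by simp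
    then show "\<forall>\<^sub>F t in A. dist (F t) L < e"
      using G(2)[of n] by eventually_elim (use n in \<open>unfold dist_real_def, linarith\<close>)
  qed
  then show ?thesis ..
qed

section \<open>The limit functional of a solution\<close>

context problem1_solution
begin

definition limit_functional :: "(real \<Rightarrow> real) \<Rightarrow> real" where
  "limit_functional f = Lim at_top (\<lambda>t. \<integral>x. f x \<partial>m t)"

lemma moment_converges: "\<exists>l. ((\<lambda>t. \<integral>x. x ^ n \<partial>m t) \<longlongrightarrow> l) at_top"
proof (rule decreasing_bounded_below_converges[where b = 0])
  have "convex_on {0..1} (\<lambda>x::real. x ^ n)"
    by (cases "even n")
      (auto intro: convex_on_subset[OF convex_power_even] convex_on_subset[OF convex_power_odd])
  then show "(\<integral>x. x ^ n \<partial>m t) \<le> (\<integral>x. x ^ n \<partial>m s)" if "0 \<le> s" "s \<le> t" for s t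
    using that by (intro convex_decreasing continuous_intros)
  show "0 \<le> (\<integral>x. x ^ n \<partial>m t)" if "0 \<le> t" for t
    by (intro Bochner_Integration.integral_nonneg) (simp add: unit_probsD(3)[OF unit_prob[OF that]])
qed

lemma integral_converges:
  fixes f :: "real \<Rightarrow> real"
  assumes f: "continuous_on {0..1} f"
  shows "\<exists>l. ((\<lambda>t. \<integral>x. f x \<partial>m t) \<longlongrightarrow> l) at_top"
proof (rule converges_if_uniformly_near_convergent[OF trivial_limit_at_top_linorder])
  fix e :: real assume "0 < e"
  from polynomial_approximation_unit[OF f this] obtain a n
    where p: "\<And>x. x \<in> {0..1} \<Longrightarrow> \<bar>f x - (\<Sum>i\<le>n. a i * x ^ i)\<bar> < e" by metis
  let ?p = "\<lambda>x. \<Sum>i\<le>n. a i * x ^ i"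
  have pc: "continuous_on {0..1} ?p" by (intro continuous_intros)
  have xc: "continuous_on {0..1} (\<lambda>x::real. x ^ i)" for i by (intro continuous_intros)
  obtain l where l: "\<And>i. ((\<lambda>t. \<integral>x. x ^ i \<partial>m t) \<longlongrightarrow> l i) at_top"
    using moment_converges by metis
  have "((\<lambda>t. \<Sum>i\<le>n. a i * (\<integral>x. x ^ i \<partial>m t)) \<longlongrightarrow> (\<Sum>i\<le>n. a i * l i)) at_top"
    by (intro tendsto_intros l)
  moreover have "\<forall>\<^sub>F t in at_top. \<bar>(\<integral>x. f x \<partial>m t) - (\<Sum>i\<le>n. a i * (\<integral>x. x ^ i \<partial>m t))\<bar> \<le> e"
  proof (rule eventually_at_top_if_nonneg)
    fix t :: real assume t: "0 \<le> t"
    note int = unit_integrable[OF unit_prob[OF t] unit_continuous]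
    have "(\<integral>x. f x \<partial>m t) - (\<Sum>i\<le>n. a i * (\<integral>x. x ^ i \<partial>m t)) = (\<integral>x. f x - ?p x \<partial>m t)"
      using int[OF f f] int[OF pc pc] int[OF xc xc]
      by (simp add: Bochner_Integration.integral_sum)
    also have "\<bar>\<dots>\<bar> \<le> e"
      using p by (intro unit_integral_abs_le[OF unit_prob[OF t]] unit_continuous
          continuous_intros f less_imp_le) auto
    finally show "\<bar>(\<integral>x. f x \<partial>m t) - (\<Sum>i\<le>n. a i * (\<integral>x. x ^ i \<partial>m t))\<bar> \<le> e" .
  qed
  ultimately show "\<exists>G l. (G \<longlongrightarrow> l) at_top \<and> (\<forall>\<^sub>F t in at_top. \<bar>(\<integral>x. f x \<partial>m t) - G t\<bar> \<le> e)"
    by blast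
qed

lemma limit_functional:
  assumes "continuous_on {0..1} f"
  shows "((\<lambda>t. \<integral>x. f x \<partial>m t) \<longlongrightarrow> limit_functional f) at_top"
  using integral_converges[OF assms] tendsto_Lim[OF trivial_limit_at_top_linorder]
  unfolding limit_functional_def by blast

lemma limit_functional_eqI:
  assumes "continuous_on {0..1} f" "((\<lambda>t. \<integral>x. f x \<partial>m t) \<longlongrightarrow> l) at_top"
  shows "limit_functional f = l"
  by (rule tendsto_unique[OF trivial_limit_at_top_linorder limit_functional[OF assms(1)] assms(2)])

lemma limit_functional_le:
  assumes "continuous_on {0..1} f" "\<And>t. 0 \<le> t \<Longrightarrow> (\<integral>x. f x \<partial>m t) \<le> b"
  shows "limit_functional f \<le> b"
  by (rule tendsto_upperbound[OF limit_functional[OF assms(1)]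
        eventually_at_top_if_nonneg[OF assms(2)] trivial_limit_at_top_linorder])

text \<open>If the product were positive, the second moment would from some time on decrease at a rate at
  least \<open>c > 0\<close>, although it stays between \<open>0\<close> and \<open>1\<close>.\<close>

lemma limit_functional_separated:
  assumes \<epsilon>: "0 < \<epsilon>"
    and f: "continuous_on {0..1} f" "\<And>x. x \<in> {0..1} \<Longrightarrow> 0 \<le> f x \<and> f x \<le> 1"
    and g: "continuous_on {0..1} g" "\<And>x. x \<in> {0..1} \<Longrightarrow> 0 \<le> g x \<and> g x \<le> 1"
    and sep: "\<And>x y. x \<in> {0..1} \<Longrightarrow> y \<in> {0..1} \<Longrightarrow> f x * g y \<noteq> 0 \<Longrightarrow>
           \<epsilon> \<le> \<bar>x - y\<bar> \<and> \<bar>x - y\<bar> \<le> \<Delta>"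
  shows "limit_functional f * limit_functional g = 0"
proof (rule ccontr)
  let ?P = "\<lambda>t. (\<integral>x. f x \<partial>m t) * (\<integral>x. g x \<partial>m t)"
  define p where "p = limit_functional f * limit_functional g"
  assume "limit_functional f * limit_functional g \<noteq> 0"
  then have "p \<noteq> 0" by (simp only: p_def not_False_eq_True)
  have lim: "(?P \<longlongrightarrow> p) at_top"
    unfolding p_def by (intro tendsto_mult limit_functional f(1) g(1))
  have "0 \<le> ?P t" if "0 \<le> t" for t
    by (intro mult_nonneg_nonneg Bochner_Integration.integral_nonneg)
      (simp_all add: f(2) g(2) unit_probsD(3)[OF unit_prob[OF that]])
  then have "0 \<le> p"
    by (intro tendsto_lowerbound[OF lim _ trivial_limit_at_top_linorder] eventually_at_top_if_nonneg)
  with \<open>p \<noteq> 0\<close> have "0 < p" by simp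
  then have "\<forall>\<^sub>F t in at_top. p / 2 < ?P t" using order_tendstoD(1)[OF lim, of "p / 2"] by simp
  then obtain T0 where T0: "\<And>t. T0 \<le> t \<Longrightarrow> p / 2 < ?P t" by (auto simp: eventually_at_top_linorder)
  define T where "T = max 0 T0"
  define c where "c = 2 * w * (1 - w) * \<epsilon>\<^sup>2 * (p / 2)"
  have "0 < c" using w \<epsilon> \<open>0 < p\<close> by (simp add: c_def)
  have sq: "continuous_on {0..1} (\<lambda>x::real. x\<^sup>2)" by (intro continuous_intros)
  have drop: "(\<integral>x. x\<^sup>2 \<partial>m t) - (\<integral>x. x\<^sup>2 \<partial>m T) \<le> - c * (t - T)" if "T \<le> t" for t
  proof (rule increment_le[OF unit_continuous[OF sq] _ that])
    show "0 \<le> T" by (simp add: T_def)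
    fix u assume u: "T \<le> u"
    have "interaction \<Delta> w (\<lambda>x. x\<^sup>2) (m u) \<le> - (2 * w * (1 - w) * \<epsilon>\<^sup>2) * ?P u"
      using u \<epsilon> by (intro interaction_square_le unit_prob w f g sep) (auto simp: T_def)
    also have "\<dots> \<le> - (2 * w * (1 - w) * \<epsilon>\<^sup>2) * (p / 2)"
      using w T0[of u] u by (intro mult_left_mono_neg) (auto simp: T_def)
    finally show "interaction \<Delta> w (\<lambda>x. x\<^sup>2) (m u) \<le> - c" by (simp add: c_def)
  qed
  have "0 \<le> T" by (simp add: T_def)
  have range: "\<bar>\<integral>x. x\<^sup>2 \<partial>m t\<bar> \<le> 1" if "0 \<le> t" for t
    by (intro unit_integral_abs_le[OF unit_prob[OF that]] unit_continuous sq)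
      (auto simp: power_le_one)
  \<comment> \<open>After a further time \<open>3 / c\<close> the second moment has dropped by \<open>3\<close>, while two of its values
    differ by at most \<open>2\<close> according to the crude bound just shown.\<close>
  have "0 \<le> 3 / c" using \<open>0 < c\<close> by simp
  then have "- 2 \<le> - c * (T + 3 / c - T)"
    using drop[of "T + 3 / c"] range[of "T + 3 / c"] range[of T] \<open>0 \<le> T\<close> by linarith
  then show False using \<open>0 < c\<close> by simp
qed

lemma separated_limit_functional: "separated_functional limit_functional \<Delta>"
proof
  show "0 < \<Delta>" by (rule \<Delta>_pos)
next
  fix f g :: "real \<Rightarrow> real" assume f: "continuous_on {0..1} f" and g: "continuous_on {0..1} g"
  have "((\<lambda>t. (\<integral>x. f x \<partial>m t) + (\<integral>x. g x \<partial>m t)) \<longlongrightarrow> limit_functional f + limit_functional g) at_top"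
    by (intro tendsto_intros limit_functional f g)
  moreover have "\<forall>\<^sub>F t in at_top. (\<integral>x. f x \<partial>m t) + (\<integral>x. g x \<partial>m t) = (\<integral>x. f x + g x \<partial>m t)"
    by (rule eventually_at_top_if_nonneg) (simp add: unit_integrable unit_prob unit_continuous f g)
  ultimately have "((\<lambda>t. \<integral>x. f x + g x \<partial>m t) \<longlongrightarrow> limit_functional f + limit_functional g) at_top"
    by (rule Lim_transform_eventually)
  then show "limit_functional (\<lambda>x. f x + g x) = limit_functional f + limit_functional g"
    by (intro limit_functional_eqI continuous_intros f g)
next
  fix f :: "real \<Rightarrow> real" and c :: real assume f: "continuous_on {0..1} f"
  have "((\<lambda>t. c * (\<integral>x. f x \<partial>m t)) \<longlongrightarrow> c * limit_functional f) at_top"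
    by (intro tendsto_intros limit_functional f)
  then show "limit_functional (\<lambda>x. c * f x) = c * limit_functional f"
    by (intro limit_functional_eqI continuous_intros f) simp
next
  fix f g :: "real \<Rightarrow> real"
  assume f: "continuous_on {0..1} f" and g: "continuous_on {0..1} g"
    and le: "\<And>x. x \<in> {0..1} \<Longrightarrow> f x \<le> g x"
  show "limit_functional f \<le> limit_functional g"
  proof (rule tendsto_le[OF trivial_limit_at_top_linorder limit_functional[OF g] limit_functional[OF f]])
    show "\<forall>\<^sub>F t in at_top. (\<integral>x. f x \<partial>m t) \<le> (\<integral>x. g x \<partial>m t)"
      by (rule eventually_at_top_if_nonneg) (intro unit_integral_mono unit_prob unit_continuous f g le)
  qed
next
  have "\<forall>\<^sub>F t in at_top. 1 = (\<integral>x. (1::real) \<partial>m t)"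
  proof (rule eventually_at_top_if_nonneg)
    fix t :: real assume "0 \<le> t"
    interpret prob_space "m t" by (rule unit_probsD[OF unit_prob[OF \<open>0 \<le> t\<close>]])
    show "1 = (\<integral>x. (1::real) \<partial>m t)" by (simp add: prob_space)
  qed
  then have "((\<lambda>t. \<integral>x. (1::real) \<partial>m t) \<longlongrightarrow> 1) at_top"
    by (rule Lim_transform_eventually[OF tendsto_const])
  then show "limit_functional (\<lambda>_. 1) = 1"
    by (intro limit_functional_eqI) auto
qed (rule limit_functional_separated)

end

section \<open>Finitely supported measures\<close>

definition atomic_measure :: "real set \<Rightarrow> (real \<Rightarrow> real) \<Rightarrow> real measure" where
  "atomic_measure S \<alpha> = distr (point_measure S (\<lambda>s. ennreal (\<alpha> s))) unit_borel (\<lambda>x. x)"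

lemma sets_atomic_measure: "sets (atomic_measure S \<alpha>) = sets unit_borel"
  by (simp add: atomic_measure_def)

lemma emeasure_atomic_measure:
  assumes "finite S" "S \<subseteq> {0..1}" "A \<in> sets unit_borel"
  shows "emeasure (atomic_measure S \<alpha>) A = (\<Sum>s\<in>S. ennreal (\<alpha> s) * indicator A s)"
proof -
  have "emeasure (atomic_measure S \<alpha>) A = (\<Sum>s\<in>A \<inter> S. ennreal (\<alpha> s))"
    unfolding atomic_measure_def using assms
    by (subst emeasure_distr)
      (auto simp: space_point_measure emeasure_point_measure_finite space_restrict_space)
  also have "\<dots> = (\<Sum>s\<in>S. ennreal (\<alpha> s) * indicator A s)"
    using assms(1) by (intro sum.mono_neutral_cong_left) (auto simp: indicator_def)
  finally show ?thesis .
qed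

lemma integral_atomic_measure:
  fixes f :: "real \<Rightarrow> real"
  assumes "finite S" "S \<subseteq> {0..1}" "\<And>s. s \<in> S \<Longrightarrow> 0 \<le> \<alpha> s" "f \<in> borel_measurable unit_borel"
  shows "(\<integral>x. f x \<partial>atomic_measure S \<alpha>) = (\<Sum>s\<in>S. \<alpha> s * f s)"
  unfolding atomic_measure_def using assms
  by (subst integral_distr)
    (auto simp: space_restrict_space lebesgue_integral_point_measure_finite)

lemma atomic_measure_unit_probs:
  assumes "finite S" "S \<subseteq> {0..1}" "\<And>s. s \<in> S \<Longrightarrow> 0 \<le> \<alpha> s" "(\<Sum>s\<in>S. \<alpha> s) = 1"
  shows "atomic_measure S \<alpha> \<in> unit_probs"
proof -
  have sp: "space (atomic_measure S \<alpha>) = {0..1}"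
    by (simp add: atomic_measure_def space_restrict_space)
  have "{0..1} \<in> sets unit_borel" by (simp add: sets_restrict_space_iff)
  then have "emeasure (atomic_measure S \<alpha>) {0..1} = (\<Sum>s\<in>S. ennreal (\<alpha> s) * indicator {0..1} s)"
    by (rule emeasure_atomic_measure[OF assms(1,2)])
  also have "\<dots> = (\<Sum>s\<in>S. ennreal (\<alpha> s))"
    using assms(2) by (intro sum.cong) (auto simp: indicator_def)
  also have "\<dots> = 1" using assms(3,4) by (simp add: sum_ennreal)
  finally have "prob_space (atomic_measure S \<alpha>)" by (intro prob_spaceI) (simp add: sp)
  then show ?thesis by (simp add: space_prob_algebra sets_atomic_measure)
qed

lemma atomic_measure_singleton:
  assumes "x \<in> {0..1}" "\<alpha> x = 1"
  shows "atomic_measure {x} \<alpha> = return unit_borel x"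
proof (rule measure_eqI)
  fix A assume "A \<in> sets (atomic_measure {x} \<alpha>)"
  then have "A \<in> sets unit_borel" by (simp add: sets_atomic_measure)
  then show "emeasure (atomic_measure {x} \<alpha>) A = emeasure (return unit_borel x) A"
    using assms emeasure_atomic_measure[of "{x}" A \<alpha>] by simp
qed (simp add: sets_atomic_measure)

lemma atomic_measure_partial_consensus:
  assumes fin: "finite S" and S01: "S \<subseteq> {0..1}" and pos: "\<And>s. s \<in> S \<Longrightarrow> 0 < \<alpha> s"
    and one: "(\<Sum>s\<in>S. \<alpha> s) = 1"
    and sep: "\<And>x y. x \<in> S \<Longrightarrow> y \<in> S \<Longrightarrow> x \<noteq> y \<Longrightarrow> \<Delta> \<le> \<bar>x - y\<bar>"
  shows "partial_consensus \<Delta> (card S) (atomic_measure S \<alpha>)"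
proof -
  obtain h where h: "bij_betw h {1..card S} S" using ex_bij_betw_nat_finite_1[OF fin] by blast
  note in_S = bij_betwE[OF h, rule_format]
  have weights: "emeasure (atomic_measure S \<alpha>) A =
      (\<Sum>i=1..card S. ennreal (\<alpha> (h i)) * emeasure (return unit_borel (h i)) A)"
    if "A \<in> sets unit_borel" for A
    using that sum.reindex_bij_betw[OF h, of "\<lambda>s. ennreal (\<alpha> s) * indicator A s"]
    by (simp add: emeasure_atomic_measure[OF fin S01])
  have total: "(\<Sum>i=1..card S. \<alpha> (h i)) = 1"
    using sum.reindex_bij_betw[OF h, of \<alpha>] one by simp
  have sep_h: "\<Delta> \<le> \<bar>h i - h j\<bar>" if "i \<in> {1..card S}" "j \<in> {1..card S}" "i \<noteq> j" for i j
    using that bij_betw_imp_inj_on[OF h] by (intro sep in_S) (auto dest: inj_onD)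
  show ?thesis
    unfolding partial_consensus_def sets_atomic_measure
    by (intro conjI refl, rule exI[where x = "\<lambda>i. \<alpha> (h i)"], rule exI[where x = h])
      (use weights total sep_h pos in_S S01 in blast)
qed

section \<open>Symmetric initial conditions\<close>

text \<open>Two point masses whose first and third moments vanish sit at opposite points. The first moment
  alone would allow unequal weights at unequal distances.\<close>

lemma balanced_pair_symmetric:
  fixes \<alpha> \<beta> u v :: real
  assumes "0 < \<alpha>" "0 < \<beta>" "u \<noteq> v" and 1: "\<alpha> * u + \<beta> * v = 0" and 3: "\<alpha> * u ^ 3 + \<beta> * v ^ 3 = 0"
  shows "u = - v"
proof -
  have "\<alpha> * u * ((u - v) * (u + v)) = (\<alpha> * u ^ 3 + \<beta> * v ^ 3) - v\<^sup>2 * (\<alpha> * u + \<beta> * v)"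
    by (simp add: algebra_simps power2_eq_square power3_eq_cube)
  then have "u = 0 \<or> u = - v" using assms by auto
  moreover have "v = 0" if "u = 0" using 1 that \<open>0 < \<beta>\<close> by simp
  ultimately show ?thesis by auto
qed

context problem1_solution
begin

text \<open>The weights of the limit are the values of the limit functional on tents. Two atoms would be
  mirror images of each other, so the mean distance to \<open>1/2\<close> would be half of their distance,
  contradicting the bound on the initial spread, which cannot increase.\<close>

lemma symmetric_limit_consensus:
  assumes sym: "symmetric_measure m0" and spread: "2 * (\<integral>x. \<bar>x - 1 / 2\<bar> \<partial>m0) < \<Delta>"
  shows "\<exists>\<nu>\<in>unit_probs. weakly_converges m \<nu> \<and>
           (total_consensus \<nu> \<or> (\<exists>c\<ge>3. partial_consensus \<Delta> c \<nu>))"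
proof -
  interpret separated_functional limit_functional \<Delta> by (rule separated_limit_functional)
  define \<alpha> where "\<alpha> = (\<lambda>s. limit_functional (tent s \<Delta>))"
  have pos: "0 < \<alpha> s" if "s \<in> atoms" for s using that \<Delta>_pos by (auto simp: \<alpha>_def atoms_def)
  have atoms_unit: "atoms \<subseteq> {0..1}" by (auto simp: atoms_def)
  have lim: "limit_functional f = (\<Sum>s\<in>atoms. \<alpha> s * f s)" if "continuous_on {0..1} f" for f
    unfolding \<alpha>_def by (rule L_eq_sum[OF that])
  have one: "(\<Sum>s\<in>atoms. \<alpha> s) = 1" using lim[of "\<lambda>_. 1"] L_one by simp
  define \<nu> where "\<nu> = atomic_measure atoms \<alpha>"
  have "\<nu> \<in> unit_probs"
    unfolding \<nu>_def using pos by (intro atomic_measure_unit_probs finite_atoms atoms_unit one less_imp_le)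
  moreover have "weakly_converges m \<nu>"
    unfolding weakly_converges_def
  proof (intro allI impI)
    fix f :: "real \<Rightarrow> real" assume f: "continuous_on {0..1} f"
    have "(\<integral>x. f x \<partial>\<nu>) = limit_functional f"
      unfolding \<nu>_def lim[OF f] using pos
      by (intro integral_atomic_measure finite_atoms atoms_unit less_imp_le unit_continuous(1) f)
    then show "((\<lambda>t. \<integral>x. f x \<partial>m t) \<longlongrightarrow> (\<integral>x. f x \<partial>\<nu>)) at_top"
      using limit_functional[OF f] by simp
  qed
  moreover have "total_consensus \<nu> \<or> (\<exists>c\<ge>3. partial_consensus \<Delta> c \<nu>)"
  proof -
    have "card atoms \<noteq> 0" using one finite_atoms by auto
    moreover have "card atoms \<noteq> 2"
    proof
      assume "card atoms = 2"
      then obtain a b where two: "atoms = {a, b}" "a \<noteq> b" by (auto simp: card_2_iff)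
      have balance: "\<alpha> a * (a - 1 / 2) ^ n + \<alpha> b * (b - 1 / 2) ^ n = 0" if "odd n" for n
      proof -
        have c: "continuous_on {0..1} (\<lambda>x::real. (x - 1 / 2) ^ n)" by (intro continuous_intros)
        have "(\<integral>x. (x - 1 / 2) ^ n \<partial>m t) = 0" if "0 \<le> t" for t
        proof (rule odd_integral_eq_0[OF sym that unit_continuous(1)[OF c]])
          fix x :: real assume "x \<in> {0..1}"
          then show "\<bar>(x - 1 / 2) ^ n\<bar> \<le> 1" by (auto simp: power_abs intro!: power_le_one)
          have "1 - x - 1 / 2 = - (x - 1 / 2)" by simp
          then show "(1 - x - 1 / 2) ^ n = - ((x - 1 / 2) ^ n)" by (simp only: power_minus_odd[OF \<open>odd n\<close>])
        qed
        then have "limit_functional (\<lambda>x. (x - 1 / 2) ^ n) = 0"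
          by (intro limit_functional_eqI[OF c] tendsto_eventually eventually_at_top_if_nonneg)
        then show ?thesis using lim[OF c] two by simp
      qed
      have ab: "a - 1 / 2 = - (b - 1 / 2)"
        using pos[of a] pos[of b] two balance[of 1] balance[of 3]
        by (intro balanced_pair_symmetric) auto
      have abs: "continuous_on {0..1} (\<lambda>x::real. \<bar>x - 1 / 2\<bar>)" by (intro continuous_intros)
      have "convex_on {0..1} (\<lambda>x::real. \<bar>x - 1 / 2\<bar>)"
        using convex_on_dist[of "{0..1::real}" "1 / 2"] by (simp add: dist_real_def abs_minus_commute)
      then have "limit_functional (\<lambda>x. \<bar>x - 1 / 2\<bar>) \<le> (\<integral>x. \<bar>x - 1 / 2\<bar> \<partial>m0)"
        using initial convex_decreasing[OF _ abs, of 0] by (intro limit_functional_le abs) auto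
      also have "limit_functional (\<lambda>x. \<bar>x - 1 / 2\<bar>) = \<alpha> a * \<bar>a - 1 / 2\<bar> + \<alpha> b * \<bar>b - 1 / 2\<bar>"
        using lim[OF abs] two by simp
      also have "\<dots> = (\<alpha> a + \<alpha> b) * \<bar>a - 1 / 2\<bar>"
        unfolding ab by (simp only: abs_minus_cancel distrib_right)
      also have "\<alpha> a + \<alpha> b = 1" using one two by simp
      also have "1 * \<bar>a - 1 / 2\<bar> = \<bar>a - b\<bar> / 2" using ab by (simp add: abs_if)
      finally show False using atoms_separated[of a b] two spread by simp
    qed
    moreover have "total_consensus \<nu>" if single: "card atoms = 1"
    proof -
      obtain x where x: "atoms = {x}" using card_1_singletonE[OF single] by blast
      then show ?thesis
        using atoms_unit one atomic_measure_singleton[of x \<alpha>] by (auto simp: total_consensus_def \<nu>_def)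
    qed
    moreover have "partial_consensus \<Delta> (card atoms) \<nu>"
      unfolding \<nu>_def by (intro atomic_measure_partial_consensus finite_atoms atoms_unit pos one atoms_separated)
    ultimately show ?thesis
      by (cases "card atoms \<ge> 3") (auto simp: not_le less_Suc_eq numeral_3_eq_3 numeral_2_eq_2)
  qed
  ultimately show ?thesis by blast
qed

end

theorem corollary5p4:
  fixes \<Delta> w :: real and m0 :: "real measure" and m :: "real \<Rightarrow> real measure"
  assumes "0 < \<Delta>" and "\<Delta> \<le> 1" and "0 < w" and "w < 1"
    and "m0 \<in> unit_probs"
    and "symmetric_measure m0"
    and "solves_problem1 \<Delta> w m0 m"
    and "\<Delta> > 2 * (\<integral>x. \<bar>x - 1 / 2\<bar> \<partial>m0)"
  shows "\<exists>\<nu>\<in>unit_probs. weakly_converges m \<nu> \<and>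
           (total_consensus \<nu> \<or> (\<exists>c\<ge>3. partial_consensus \<Delta> c \<nu>))"
proof -
  interpret problem1_solution \<Delta> w m0 m using assms by unfold_locales auto
  show ?thesis using assms by (intro symmetric_limit_consensus) auto
qed

end
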